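(* Let $S$ be a connected, oriented surface without boundary with nonabelian fundamental group (equivalently, $-\infty\le\chi(S)<0$). Then there is a well defined group action $A:\operatorname{MCG}(S)\times\mathcal T(S)\to\mathcal T(S)$ of the mapping class group on the set of marked, complete, Nielsen-convex hyperbolic structures on $S$, given by $$A([\psi],[X,f])=[X,f\circ\psi^{-1}].$$
   Context: All surfaces are oriented and all homeomorphisms between them are orientation preserving. "Complete" means geodesically complete. A complete hyperbolic surface $X$ is Nielsen-convex if $X$ is isometric to $\Gamma\backslash\mathbb H^2$ with $\Gamma\subset\mathrm{PSL}(2,\mathbb R)$ a torsion-free Fuchsian group of the first kind (its limit set is the whole circle at infinity). $\mathcal T(S)$ is the set of pairs $(X,f)$ with $X$ a complete Nielsen-convex hyperbolic surface and $f:S\to X$ a homeomorphism, modulo $(X_1,f_1)\sim(X_2,f_2)$ iff there is an isometry $\varphi:X_1\to X_2$ homotopic to $f_2\circ f_1^{-1}$. $\operatorname{MCG}(S)=\operatorname{Homeo}^+(S)/\operatorname{Homeo}_0(S)$, where $\operatorname{Homeo}_0(S)$ is the subgroup of homeomorphisms isotopic to the identity. *)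

theory Defs
  imports
    "HOL-Analysis.Analysis"
    "HOL-Homology.Homology"
    "HOL-Algebra.Group_Action"
begin

section \<open>Oriented surfaces\<close>

definition surface :: "'a topology \<Rightarrow> bool" where
  "surface S \<longleftrightarrow>
     Hausdorff_space S \<and> second_countable S \<and>
     (\<forall>x \<in> topspace S. \<exists>U V. openin S U \<and> x \<in> U \<and> open V \<and>
        subtopology S U homeomorphic_space top_of_set (V :: (real^2) set))"

text \<open>An orientation is a choice of a generator of the local homology group
  \<open>H\<^sub>2(S, S - x)\<close> at every point \<open>x\<close>; locally these generators must be the restrictions
  of a single class in \<open>H\<^sub>2(S, S - U)\<close>.\<close>

type_synonym 'a orientation = "'a \<Rightarrow> 'a chain set"

abbreviation local_homology :: "'a topology \<Rightarrow> 'a set \<Rightarrow> 'a chain set monoid" where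
  "local_homology S U \<equiv> relative_homology_group 2 S (topspace S - U)"

definition is_orientation :: "'a topology \<Rightarrow> 'a orientation \<Rightarrow> bool" where
  "is_orientation S \<omega> \<longleftrightarrow>
     (\<forall>x \<in> topspace S.
        \<omega> x \<in> carrier (local_homology S {x}) \<and>
        generate (local_homology S {x}) {\<omega> x} = carrier (local_homology S {x})) \<and>
     (\<forall>x \<in> topspace S. \<exists>U. openin S U \<and> x \<in> U \<and>
        (\<exists>\<alpha> \<in> carrier (local_homology S U). \<forall>y \<in> U.
           hom_induced 2 S (topspace S - U) S (topspace S - {y}) id \<alpha> = \<omega> y))"

definition oriented_surface :: "'a topology \<Rightarrow> 'a orientation \<Rightarrow> bool" where
  "oriented_surface S \<omega> \<longleftrightarrow> surface S \<and> is_orientation S \<omega>"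

definition oriented_homeo ::
  "'a topology \<Rightarrow> 'a orientation \<Rightarrow> 'b topology \<Rightarrow> 'b orientation \<Rightarrow> ('a \<Rightarrow> 'b) \<Rightarrow> bool" where
  "oriented_homeo S \<omega> T \<eta> f \<longleftrightarrow>
     homeomorphic_map S T f \<and>
     (\<forall>x \<in> topspace S.
        hom_induced 2 S (topspace S - {x}) T (topspace T - {f x}) f (\<omega> x) = \<eta> (f x))"


section \<open>The fundamental group\<close>

definition concat_paths :: "(real \<Rightarrow> 'a) \<Rightarrow> (real \<Rightarrow> 'a) \<Rightarrow> real \<Rightarrow> 'a" where
  "concat_paths p q = (\<lambda>t. if t \<le> 1/2 then p (2 * t) else q (2 * t - 1))"

definition loops_at :: "'a topology \<Rightarrow> 'a \<Rightarrow> (real \<Rightarrow> 'a) set" where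
  "loops_at S x = {p. pathin S p \<and> p 0 = x \<and> p 1 = x}"

definition loop_homotopic :: "'a topology \<Rightarrow> 'a \<Rightarrow> (real \<Rightarrow> 'a) \<Rightarrow> (real \<Rightarrow> 'a) \<Rightarrow> bool" where
  "loop_homotopic S x p q \<longleftrightarrow>
     homotopic_with (\<lambda>g. g 0 = x \<and> g 1 = x) (top_of_set {0..1}) S p q"

definition fundamental_group :: "'a topology \<Rightarrow> 'a \<Rightarrow> (real \<Rightarrow> 'a) set monoid" where
  "fundamental_group S x =
     \<lparr>carrier = loops_at S x // {(p, q). loop_homotopic S x p q},
      mult = (\<lambda>A B. {r. \<exists>p \<in> A. \<exists>q \<in> B. loop_homotopic S x (concat_paths p q) r}),
      one = {r. loop_homotopic S x (\<lambda>_. x) r}\<rparr>"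

text \<open>For connected surfaces the choice of base point is immaterial.\<close>

definition nonabelian_fundamental_group :: "'a topology \<Rightarrow> bool" where
  "nonabelian_fundamental_group S \<longleftrightarrow>
     (\<exists>x \<in> topspace S.
        \<exists>a \<in> carrier (fundamental_group S x). \<exists>b \<in> carrier (fundamental_group S x).
          a \<otimes>\<^bsub>fundamental_group S x\<^esub> b \<noteq> b \<otimes>\<^bsub>fundamental_group S x\<^esub> a)"


section \<open>The mapping class group\<close>

definition homeo_group :: "'a topology \<Rightarrow> 'a orientation \<Rightarrow> ('a \<Rightarrow> 'a) monoid" where
  "homeo_group S \<omega> =
     BijGroup (topspace S) \<lparr>carrier := {f \<in> Bij (topspace S). oriented_homeo S \<omega> S \<omega> f}\<rparr>"

definition homeo_0 :: "'a topology \<Rightarrow> 'a orientation \<Rightarrow> ('a \<Rightarrow> 'a) set" where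
  "homeo_0 S \<omega> = {f \<in> carrier (homeo_group S \<omega>). homotopic_with (homeomorphic_map S S) S S f id}"

definition MCG :: "'a topology \<Rightarrow> 'a orientation \<Rightarrow> ('a \<Rightarrow> 'a) set monoid" where
  "MCG S \<omega> = homeo_group S \<omega> Mod homeo_0 S \<omega>"

definition mapping_class :: "'a topology \<Rightarrow> 'a orientation \<Rightarrow> ('a \<Rightarrow> 'a) \<Rightarrow> ('a \<Rightarrow> 'a) set" where
  "mapping_class S \<omega> \<psi> = homeo_0 S \<omega> #>\<^bsub>homeo_group S \<omega>\<^esub> \<psi>"


section \<open>The hyperbolic plane and Fuchsian groups\<close>

definition upper_half_plane :: "complex set" where
  "upper_half_plane = {z. Im z > 0}"

definition hyp_dist :: "complex \<Rightarrow> complex \<Rightarrow> real" where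
  "hyp_dist z w = arcosh (1 + (cmod (z - w))\<^sup>2 / (2 * Im z * Im w))"

definition SL2R :: "(real^2^2) monoid" where
  "SL2R = \<lparr>carrier = {A. det A = 1}, mult = (**), one = mat 1\<rparr>"

definition PSL2R :: "(real^2^2) set monoid" where
  "PSL2R = SL2R Mod {mat 1, - mat 1}"

text \<open>The elements of \<open>PSL2R\<close> are the pairs \<open>{A, -A}\<close>, so \<open>\<Union>\<Gamma>\<close> is the preimage of
  \<open>\<Gamma>\<close> in \<open>SL(2,\<real>)\<close>. As the kernel is finite, \<open>\<Gamma>\<close> is discrete iff this preimage is.\<close>

definition fuchsian_group :: "(real^2^2) set set \<Rightarrow> bool" where
  "fuchsian_group \<Gamma> \<longleftrightarrow> subgroup \<Gamma> PSL2R \<and> discrete (\<Union>\<Gamma>)"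

definition torsion_free :: "(real^2^2) set set \<Rightarrow> bool" where
  "torsion_free \<Gamma> \<longleftrightarrow>
     (\<forall>g \<in> \<Gamma>. \<forall>n::nat. n > 0 \<and> g [^]\<^bsub>PSL2R\<^esub> n = \<one>\<^bsub>PSL2R\<^esub> \<longrightarrow> g = \<one>\<^bsub>PSL2R\<^esub>)"

definition mat_moebius :: "real^2^2 \<Rightarrow> complex \<Rightarrow> complex" where
  "mat_moebius A =
     moebius (of_real (A$1$1)) (of_real (A$1$2)) (of_real (A$2$1)) (of_real (A$2$2))"

definition fuchsian_orbit :: "(real^2^2) set set \<Rightarrow> complex \<Rightarrow> complex set" where
  "fuchsian_orbit \<Gamma> z = (\<lambda>A. mat_moebius A z) ` (\<Union>\<Gamma>)"

text \<open>The circle at infinity is taken to be the unit circle, via the Cayley transform of the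
  upper half-plane onto the unit disc.\<close>

definition cayley :: "complex \<Rightarrow> complex" where
  "cayley z = (z - \<i>) / (z + \<i>)"

definition limit_set :: "(real^2^2) set set \<Rightarrow> complex set" where
  "limit_set \<Gamma> =
     {\<xi> \<in> sphere 0 1. \<exists>z \<in> upper_half_plane. \<xi> islimpt cayley ` fuchsian_orbit \<Gamma> z}"

definition first_kind :: "(real^2^2) set set \<Rightarrow> bool" where
  "first_kind \<Gamma> \<longleftrightarrow> limit_set \<Gamma> = sphere 0 1"

definition quotient_space :: "(real^2^2) set set \<Rightarrow> complex set set" where
  "quotient_space \<Gamma> = fuchsian_orbit \<Gamma> ` upper_half_plane"

definition quotient_dist :: "complex set \<Rightarrow> complex set \<Rightarrow> real" where
  "quotient_dist a b = (INF (z, w) \<in> a \<times> b. hyp_dist z w)"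


section \<open>Hyperbolic surfaces\<close>

text \<open>A hyperbolic surface is represented by its path metric: a length metric that is locally
  isometric to the hyperbolic plane.\<close>

definition curve_length :: "'a metric \<Rightarrow> (real \<Rightarrow> 'a) \<Rightarrow> ereal" where
  "curve_length m p =
     (SUP ts \<in> {ts. sorted ts \<and> set ts \<subseteq> {0..1}}.
        ereal (\<Sum>i < length ts - 1. mdist m (p (ts ! i)) (p (ts ! Suc i))))"

definition length_metric :: "'a metric \<Rightarrow> bool" where
  "length_metric m \<longleftrightarrow>
     (\<forall>x \<in> mspace m. \<forall>y \<in> mspace m.
        ereal (mdist m x y) =
          (INF p \<in> {p. pathin (mtopology_of m) p \<and> p 0 = x \<and> p 1 = y}. curve_length m p))"

definition locally_hyperbolic :: "'a metric \<Rightarrow> bool" where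
  "locally_hyperbolic m \<longleftrightarrow>
     (\<forall>x \<in> mspace m. \<exists>r > 0. \<exists>z \<in> upper_half_plane. \<exists>h.
        bij_betw h (mball_of m x r) {w \<in> upper_half_plane. hyp_dist z w < r} \<and>
        (\<forall>u \<in> mball_of m x r. \<forall>v \<in> mball_of m x r. hyp_dist (h u) (h v) = mdist m u v))"

text \<open>Geodesics are parametrised by arc length and are only locally distance-minimising.\<close>

definition local_geodesic :: "'a metric \<Rightarrow> real set \<Rightarrow> (real \<Rightarrow> 'a) \<Rightarrow> bool" where
  "local_geodesic m I c \<longleftrightarrow>
     c \<in> I \<rightarrow> mspace m \<and>
     (\<forall>t \<in> I. \<exists>e > 0. \<forall>s \<in> I \<inter> ball t e. \<forall>s' \<in> I \<inter> ball t e. mdist m (c s) (c s') = \<bar>s - s'\<bar>)"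

definition geodesically_complete :: "'a metric \<Rightarrow> bool" where
  "geodesically_complete m \<longleftrightarrow>
     (\<forall>a b c. a < b \<and> local_geodesic m {a<..<b} c \<longrightarrow>
        (\<exists>c'. local_geodesic m UNIV c' \<and> (\<forall>t \<in> {a<..<b}. c' t = c t)))"

type_synonym 'a oriented_metric = "'a metric \<times> 'a orientation"

definition hyperbolic_surface :: "'a oriented_metric \<Rightarrow> bool" where
  "hyperbolic_surface X \<longleftrightarrow>
     oriented_surface (mtopology_of (fst X)) (snd X) \<and>
     length_metric (fst X) \<and> locally_hyperbolic (fst X)"

text \<open>The isometry onto the quotient carries no orientation condition: if it reverses the
  orientations, composing it with the map induced by \<open>z \<mapsto> - cnj z\<close> gives an orientation
  preserving isometry onto the quotient by a conjugate of \<open>\<Gamma>\<close> in \<open>PGL(2,\<real>)\<close>.\<close>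

definition nielsen_convex :: "'a oriented_metric \<Rightarrow> bool" where
  "nielsen_convex X \<longleftrightarrow>
     (\<exists>\<Gamma>. fuchsian_group \<Gamma> \<and> torsion_free \<Gamma> \<and> first_kind \<Gamma> \<and>
        (\<exists>F. bij_betw F (mspace (fst X)) (quotient_space \<Gamma>) \<and>
             (\<forall>x \<in> mspace (fst X). \<forall>y \<in> mspace (fst X).
                quotient_dist (F x) (F y) = mdist (fst X) x y)))"

definition oriented_isometry ::
  "'a oriented_metric \<Rightarrow> 'b oriented_metric \<Rightarrow> ('a \<Rightarrow> 'b) \<Rightarrow> bool" where
  "oriented_isometry X Y \<phi> \<longleftrightarrow>
     oriented_homeo (mtopology_of (fst X)) (snd X) (mtopology_of (fst Y)) (snd Y) \<phi> \<and>
     (\<forall>x \<in> mspace (fst X). \<forall>y \<in> mspace (fst X). mdist (fst Y) (\<phi> x) (\<phi> y) = mdist (fst X) x y)"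


section \<open>Marked hyperbolic structures\<close>

text \<open>The points of the hyperbolic surfaces are drawn from an arbitrary type \<open>'b\<close>. Any type
  with at least continuum many elements yields all isometry classes.\<close>

type_synonym ('a, 'b) marked = "'b oriented_metric \<times> ('a \<Rightarrow> 'b)"

definition marked_surfaces :: "'a topology \<Rightarrow> 'a orientation \<Rightarrow> ('a, 'b) marked set" where
  "marked_surfaces S \<omega> =
     {(X, f). hyperbolic_surface X \<and> geodesically_complete (fst X) \<and> nielsen_convex X \<and>
        f \<in> extensional (topspace S) \<and>
        oriented_homeo S \<omega> (mtopology_of (fst X)) (snd X) f}"

definition marking_rel ::
  "'a topology \<Rightarrow> 'a orientation \<Rightarrow> (('a, 'b) marked \<times> ('a, 'b) marked) set" where
  "marking_rel S \<omega> =
     {((X1, f1), (X2, f2)). (X1, f1) \<in> marked_surfaces S \<omega> \<and> (X2, f2) \<in> marked_surfaces S \<omega> \<and>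
        (\<exists>\<phi>. oriented_isometry X1 X2 \<phi> \<and>
             homotopic_with (\<lambda>_. True) (mtopology_of (fst X1)) (mtopology_of (fst X2))
               \<phi> (f2 \<circ> inv_into (topspace S) f1))}"

definition teichmueller :: "'a topology \<Rightarrow> 'a orientation \<Rightarrow> ('a, 'b) marked set set" where
  "teichmueller S \<omega> = marked_surfaces S \<omega> // marking_rel S \<omega>"

definition marked_class ::
  "'a topology \<Rightarrow> 'a orientation \<Rightarrow> ('a, 'b) marked \<Rightarrow> ('a, 'b) marked set" where
  "marked_class S \<omega> Xf = marking_rel S \<omega> `` {Xf}"

end

theory Submission
  imports Defs
begin

text \<open>
  Composing with \<open>f\<^sub>1\<close> on the right turns the equivalence of \<open>(X\<^sub>1, f\<^sub>1)\<close> and \<open>(X\<^sub>2, f\<^sub>2)\<close> into the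
  existence of an isometry \<open>\<phi>\<close> such that \<open>\<phi> \<circ> f\<^sub>1\<close> is homotopic to \<open>f\<^sub>2\<close>. In this form it is plainly
  preserved by precomposing both markings with \<open>\<psi>\<inverse>\<close>, so the homeomorphism group acts on
  Teichmueller space. If \<open>\<psi>\<close> is isotopic to the identity then \<open>f\<close> is homotopic to
  \<open>f \<circ> \<psi>\<inverse>\<close>, so the identity of \<open>X\<close> shows that \<open>\<psi>\<close> acts trivially and the action factors through
  the mapping class group.\<close>

section \<open>Orientation preserving homeomorphisms\<close>

text \<open>Injectivity of \<open>f\<close> forces any inverse to agree with \<open>inv_into\<close>
  on \<open>topspace T\<close>, so \<open>inv_into\<close> inherits continuity from the inverse that
  exists by assumption.\<close>

lemma homeomorphic_maps_inv_into:
  assumes "homeomorphic_map S T f"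
  shows "homeomorphic_maps S T f (inv_into (topspace S) f)"
proof -
  obtain g where g: "homeomorphic_maps S T f g"
    using assms by (auto simp: homeomorphic_map_maps)
  have "g y = inv_into (topspace S) f y" if "y \<in> topspace T" for y
    using g assms that homeomorphic_imp_surjective_map[of T S g]
    by (metis homeomorphic_imp_injective_map homeomorphic_maps_map imageI inv_into_f_eq)
  with g show ?thesis
    by (metis homeomorphic_maps_eq)
qed

text \<open>Continuity and induced maps on homology see only the values on
  \<open>topspace S\<close>. This allows passing between plain maps and the extensional ones that
  \<open>Bij\<close>, \<open>compose\<close> and \<open>restrict\<close> produce.\<close>

lemma oriented_homeo_cong:
  assumes "oriented_homeo S \<omega> T \<eta> f" and "\<And>x. x \<in> topspace S \<Longrightarrow> f x = g x"
  shows "oriented_homeo S \<omega> T \<eta> g"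
  using assms homeomorphic_map_eq[of S T f g] hom_induced_eq[of S f g]
  unfolding oriented_homeo_def by metis

lemma oriented_homeo_id:
  assumes "is_orientation S \<omega>"
  shows "oriented_homeo S \<omega> S \<omega> id"
  using assms hom_induced_id unfolding oriented_homeo_def is_orientation_def by fastforce

text \<open>By injectivity no other point is sent to \<open>f x\<close>. Hence \<open>f\<close> is a
  map of pairs, as functoriality of local homology requires.\<close>

lemma homeomorphic_map_punctured:
  assumes "homeomorphic_map S T f" and "x \<in> topspace S"
  shows "f \<in> topspace S - {x} \<rightarrow> topspace T - {f x}"
  using assms unfolding homeomorphic_eq_everything_map inj_on_def by blast

lemma oriented_homeo_compose:
  assumes f: "oriented_homeo S \<omega> T \<eta> f" and g: "oriented_homeo T \<eta> U \<zeta> g"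
  shows "oriented_homeo S \<omega> U \<zeta> (g \<circ> f)"
  unfolding oriented_homeo_def
proof (intro conjI ballI)
  have hf: "homeomorphic_map S T f" and hg: "homeomorphic_map T U g"
    using f g by (auto simp: oriented_homeo_def)
  show "homeomorphic_map S U (g \<circ> f)"
    using hf hg by (rule homeomorphic_map_compose)
  fix x assume x: "x \<in> topspace S"
  then have fx: "f x \<in> topspace T"
    using hf homeomorphic_imp_surjective_map by blast
  show "hom_induced 2 S (topspace S - {x}) U (topspace U - {(g \<circ> f) x}) (g \<circ> f) (\<omega> x) = \<zeta> ((g \<circ> f) x)"
    using f g x fx hom_induced_compose'[OF homeomorphic_imp_continuous_map[OF hf]
        homeomorphic_map_punctured[OF hf x] homeomorphic_imp_continuous_map[OF hg]
        homeomorphic_map_punctured[OF hg fx], of 2 "\<omega> x"]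
    by (simp add: oriented_homeo_def)
qed

text \<open>Write \<open>\<eta> y\<close> as the image under \<open>f\<close> of the local class at
  the preimage of \<open>y\<close>. By functoriality the inverse carries it back to that class,
  because the composite fixes \<open>topspace S\<close> pointwise.\<close>

lemma oriented_homeo_inv_into:
  assumes f: "oriented_homeo S \<omega> T \<eta> f" and "is_orientation S \<omega>"
  shows "oriented_homeo T \<eta> S \<omega> (inv_into (topspace S) f)" (is "oriented_homeo T \<eta> S \<omega> ?g")
  unfolding oriented_homeo_def
proof (intro conjI ballI)
  have hf: "homeomorphic_map S T f"
    using f by (simp add: oriented_homeo_def)
  then have hg: "homeomorphic_map T S ?g"
    and gf: "\<And>x. x \<in> topspace S \<Longrightarrow> ?g (f x) = x"
    and fg: "\<And>y. y \<in> topspace T \<Longrightarrow> f (?g y) = y"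
    using homeomorphic_maps_inv_into[OF hf] by (auto simp: homeomorphic_maps_map)
  show "homeomorphic_map T S ?g" by (fact hg)
  fix y assume y: "y \<in> topspace T"
  then have x: "?g y \<in> topspace S"
    using hg homeomorphic_imp_surjective_map by blast
  \<comment> \<open>Membership in the local homology group is what allows a map fixing every point
    to act as the identity on this class.\<close>
  have \<omega>: "\<omega> (?g y) \<in> carrier (local_homology S {?g y})"
    using assms(2) x by (simp add: is_orientation_def)
  have fp: "f \<in> topspace S - {?g y} \<rightarrow> topspace T - {y}"
    using homeomorphic_map_punctured[OF hf x] fg[OF y] by simp
  have "hom_induced 2 T (topspace T - {y}) S (topspace S - {?g y}) ?g (\<eta> y)
      = hom_induced 2 T (topspace T - {y}) S (topspace S - {?g y}) ?g
          (hom_induced 2 S (topspace S - {?g y}) T (topspace T - {y}) f (\<omega> (?g y)))"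
    using f x fg[OF y] unfolding oriented_homeo_def by metis
  also have "\<dots> = hom_induced 2 S (topspace S - {?g y}) S (topspace S - {?g y}) (?g \<circ> f) (\<omega> (?g y))"
    using homeomorphic_imp_continuous_map[OF hf] fp homeomorphic_imp_continuous_map[OF hg]
      homeomorphic_map_punctured[OF hg y] by (rule hom_induced_compose')
  also have "\<dots> = \<omega> (?g y)"
    using \<omega> gf by (intro hom_induced_id_gen)
      (auto intro: continuous_map_compose homeomorphic_imp_continuous_map[OF hf]
        homeomorphic_imp_continuous_map[OF hg])
  finally show "hom_induced 2 T (topspace T - {y}) S (topspace S - {?g y}) ?g (\<eta> y) = \<omega> (?g y)" .
qed

section \<open>The homeomorphism group and its identity component\<close>

lemma carrier_homeo_group:
  "carrier (homeo_group S \<omega>) = {f \<in> Bij (topspace S). oriented_homeo S \<omega> S \<omega> f}"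
  by (simp add: homeo_group_def)

lemma mult_homeo_group:
  assumes "f \<in> carrier (homeo_group S \<omega>)" and "g \<in> carrier (homeo_group S \<omega>)"
  shows "f \<otimes>\<^bsub>homeo_group S \<omega>\<^esub> g = compose (topspace S) f g"
  using assms by (simp add: homeo_group_def BijGroup_def)

lemma one_homeo_group: "\<one>\<^bsub>homeo_group S \<omega>\<^esub> = (\<lambda>x \<in> topspace S. x)"
  by (simp add: homeo_group_def BijGroup_def)

lemma subgroup_homeo_group:
  assumes "is_orientation S \<omega>"
  shows "subgroup {f \<in> Bij (topspace S). oriented_homeo S \<omega> S \<omega> f} (BijGroup (topspace S))"
proof (rule group.subgroupI[OF group_BijGroup])
  show "{f \<in> Bij (topspace S). oriented_homeo S \<omega> S \<omega> f} \<subseteq> carrier (BijGroup (topspace S))"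
    by (auto simp: BijGroup_def)
  have "oriented_homeo S \<omega> S \<omega> (\<lambda>x \<in> topspace S. x)"
    using oriented_homeo_id[OF assms] by (rule oriented_homeo_cong) simp
  then show "{f \<in> Bij (topspace S). oriented_homeo S \<omega> S \<omega> f} \<noteq> {}"
    using id_Bij by blast
next
  fix f assume f: "f \<in> {f \<in> Bij (topspace S). oriented_homeo S \<omega> S \<omega> f}"
  then have "oriented_homeo S \<omega> S \<omega> (inv_into (topspace S) f)"
    using oriented_homeo_inv_into assms by blast
  then have "oriented_homeo S \<omega> S \<omega> (restrict (inv_into (topspace S) f) (topspace S))"
    by (rule oriented_homeo_cong) simp
  then show "inv\<^bsub>BijGroup (topspace S)\<^esub> f \<in> {f \<in> Bij (topspace S). oriented_homeo S \<omega> S \<omega> f}"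
    using f restrict_inv_into_Bij by (auto simp: inv_BijGroup)
next
  fix f g assume fg: "f \<in> {f \<in> Bij (topspace S). oriented_homeo S \<omega> S \<omega> f}"
    "g \<in> {f \<in> Bij (topspace S). oriented_homeo S \<omega> S \<omega> f}"
  then have "oriented_homeo S \<omega> S \<omega> (f \<circ> g)"
    using oriented_homeo_compose by blast
  then have "oriented_homeo S \<omega> S \<omega> (compose (topspace S) f g)"
    by (rule oriented_homeo_cong) (simp add: compose_eq)
  then show "f \<otimes>\<^bsub>BijGroup (topspace S)\<^esub> g \<in> {f \<in> Bij (topspace S). oriented_homeo S \<omega> S \<omega> f}"
    using fg by (simp add: BijGroup_def compose_Bij)
qed

lemma group_homeo_group:
  assumes "is_orientation S \<omega>"
  shows "group (homeo_group S \<omega>)"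
  unfolding homeo_group_def
  using subgroup_homeo_group[OF assms] group_BijGroup by (rule subgroup.subgroup_is_group)

text \<open>Inverses in a subgroup are those of the ambient group, here \<open>BijGroup\<close>,
  whose inverses are restricted to stay extensional.\<close>

lemma inv_homeo_group:
  assumes "is_orientation S \<omega>" and "f \<in> carrier (homeo_group S \<omega>)"
  shows "inv\<^bsub>homeo_group S \<omega>\<^esub> f = restrict (inv_into (topspace S) f) (topspace S)"
  using group.m_inv_consistent[OF group_BijGroup subgroup_homeo_group[OF assms(1)], of f] assms(2)
  by (simp add: carrier_homeo_group inv_BijGroup) (simp add: homeo_group_def)

lemma homeo_group_imp_homeomorphic_map:
  "f \<in> carrier (homeo_group S \<omega>) \<Longrightarrow> homeomorphic_map S S f"
  by (simp add: carrier_homeo_group oriented_homeo_def)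

section \<open>Isotopies and the normal subgroup of homeomorphisms isotopic to the identity\<close>

lemma homotopic_through_homeos_cong:
  assumes "homotopic_with (homeomorphic_map S S) S S f g"
    and "\<And>x. x \<in> topspace S \<Longrightarrow> f' x = f x" and "\<And>x. x \<in> topspace S \<Longrightarrow> g' x = g x"
  shows "homotopic_with (homeomorphic_map S S) S S f' g'"
  using assms
proof (rule homotopic_with_eq)
  show "homeomorphic_map S S h \<longleftrightarrow> homeomorphic_map S S k"
    if "\<And>x. x \<in> topspace S \<Longrightarrow> h x = k x" for h k
    using that homeomorphic_map_eq[of S S h k] homeomorphic_map_eq[of S S k h] by metis
qed

lemma homotopic_through_homeos_compose_left:
  assumes "homotopic_with (homeomorphic_map S S) S S f g" and "homeomorphic_map S S h"
  shows "homotopic_with (homeomorphic_map S S) S S (h \<circ> f) (h \<circ> g)"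
  using assms by (blast intro: homotopic_with_compose_continuous_map_left
      homeomorphic_imp_continuous_map homeomorphic_map_compose)

lemma homotopic_through_homeos_compose_right:
  assumes "homotopic_with (homeomorphic_map S S) S S f g" and "homeomorphic_map S S h"
  shows "homotopic_with (homeomorphic_map S S) S S (f \<circ> h) (g \<circ> h)"
  using assms by (blast intro: homotopic_with_compose_continuous_map_right
      homeomorphic_imp_continuous_map homeomorphic_map_compose)

text \<open>Isotopies may be composed with a fixed homeomorphism. For inverses,
  \<open>g = g \<circ> id\<close> is isotopic to \<open>g \<circ> f\<close>, the identity; for
  products, \<open>f \<circ> g\<close> is isotopic to \<open>f \<circ> id\<close> and then to
  \<open>id\<close>.\<close>

lemma subgroup_homeo_0:
  assumes "is_orientation S \<omega>"
  shows "subgroup (homeo_0 S \<omega>) (homeo_group S \<omega>)"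
proof -
  interpret G: group "homeo_group S \<omega>"
    using assms by (rule group_homeo_group)
  show ?thesis
  proof (rule G.subgroupI)
    show "homeo_0 S \<omega> \<subseteq> carrier (homeo_group S \<omega>)"
      by (auto simp: homeo_0_def)
    have "homotopic_with (homeomorphic_map S S) S S id id"
      by simp
    \<comment> \<open>The unit of \<open>homeo_group\<close> is the restricted identity, which
      differs from \<open>id\<close> outside \<open>topspace S\<close>.\<close>
    then have "homotopic_with (homeomorphic_map S S) S S (\<lambda>x \<in> topspace S. x) id"
      by (rule homotopic_through_homeos_cong) auto
    then show "homeo_0 S \<omega> \<noteq> {}"
      using G.one_closed by (auto simp: homeo_0_def one_homeo_group)
  next
    fix f assume "f \<in> homeo_0 S \<omega>"
    then have f: "f \<in> carrier (homeo_group S \<omega>)"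
      and hom: "homotopic_with (homeomorphic_map S S) S S f id"
      by (auto simp: homeo_0_def)
    let ?g = "inv\<^bsub>homeo_group S \<omega>\<^esub> f"
    have g: "homeomorphic_map S S ?g"
      using f G.inv_closed homeo_group_imp_homeomorphic_map by blast
    have gf: "?g (f x) = x" if "x \<in> topspace S" for x
    proof -
      have "compose (topspace S) ?g f x = x"
        using f that G.l_inv[OF f] by (simp add: mult_homeo_group one_homeo_group)
      then show ?thesis
        using that by (simp add: compose_eq)
    qed
    have "homotopic_with (homeomorphic_map S S) S S (?g \<circ> id) (?g \<circ> f)"
      using homotopic_with_symD[OF hom] g by (rule homotopic_through_homeos_compose_left)
    then have "homotopic_with (homeomorphic_map S S) S S ?g id"
      by (rule homotopic_through_homeos_cong) (auto simp: gf)
    then show "?g \<in> homeo_0 S \<omega>"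
      using f by (simp add: homeo_0_def)
  next
    fix f g assume "f \<in> homeo_0 S \<omega>" "g \<in> homeo_0 S \<omega>"
    then have f: "f \<in> carrier (homeo_group S \<omega>)"
      and homf: "homotopic_with (homeomorphic_map S S) S S f id"
      and g: "g \<in> carrier (homeo_group S \<omega>)"
      and homg: "homotopic_with (homeomorphic_map S S) S S g id"
      by (auto simp: homeo_0_def)
    have "homotopic_with (homeomorphic_map S S) S S (f \<circ> g) (f \<circ> id)"
      using homg homeo_group_imp_homeomorphic_map[OF f]
      by (rule homotopic_through_homeos_compose_left)
    then have "homotopic_with (homeomorphic_map S S) S S (f \<circ> g) id"
      using homf homotopic_with_trans by fastforce
    then have "homotopic_with (homeomorphic_map S S) S S (compose (topspace S) f g) id"
      by (rule homotopic_through_homeos_cong) (auto simp: compose_eq)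
    then show "f \<otimes>\<^bsub>homeo_group S \<omega>\<^esub> g \<in> homeo_0 S \<omega>"
      using G.m_closed[OF f g] f g by (simp add: homeo_0_def mult_homeo_group)
  qed
qed

text \<open>Conjugating every stage of an isotopy from \<open>f\<close> to \<open>id\<close> by
  \<open>g\<close> gives an isotopy from the conjugate of \<open>f\<close> to the identity.\<close>

lemma normal_homeo_0:
  assumes "is_orientation S \<omega>"
  shows "homeo_0 S \<omega> \<lhd> homeo_group S \<omega>"
proof -
  interpret G: group "homeo_group S \<omega>"
    using assms by (rule group_homeo_group)
  show ?thesis
  proof (rule G.normal_invI[OF subgroup_homeo_0[OF assms]])
    fix g f assume g: "g \<in> carrier (homeo_group S \<omega>)" and "f \<in> homeo_0 S \<omega>"
    then have f: "f \<in> carrier (homeo_group S \<omega>)"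
      and hom: "homotopic_with (homeomorphic_map S S) S S f id"
      by (auto simp: homeo_0_def)
    let ?g' = "inv\<^bsub>homeo_group S \<omega>\<^esub> g"
    have g': "?g' \<in> carrier (homeo_group S \<omega>)"
      using g by simp
    have gg': "g (?g' x) = x" if "x \<in> topspace S" for x
    proof -
      have "compose (topspace S) g ?g' x = x"
        using that mult_homeo_group[OF g g'] G.r_inv[OF g] by (metis one_homeo_group restrict_apply')
      then show ?thesis
        using that by (simp add: compose_eq)
    qed
    \<comment> \<open>The inner \<open>compose\<close> is evaluated at \<open>?g' x\<close>, so this
      point must lie in \<open>topspace S\<close> for it to unfold.\<close>
    have g'im: "?g' x \<in> topspace S" if "x \<in> topspace S" for x
      using that g' by (auto simp: carrier_homeo_group dest!: Bij_imp_funcset)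
    have conj: "g \<otimes>\<^bsub>homeo_group S \<omega>\<^esub> f \<otimes>\<^bsub>homeo_group S \<omega>\<^esub> ?g'
        = compose (topspace S) (compose (topspace S) g f) ?g'"
      using mult_homeo_group[OF G.m_closed[OF g f] g'] mult_homeo_group[OF g f] by simp
    have "homotopic_with (homeomorphic_map S S) S S (g \<circ> f \<circ> ?g') (g \<circ> id \<circ> ?g')"
      using hom g g' homeo_group_imp_homeomorphic_map homotopic_through_homeos_compose_left
        homotopic_through_homeos_compose_right by meson
    then have "homotopic_with (homeomorphic_map S S) S S
        (compose (topspace S) (compose (topspace S) g f) ?g') id"
      by (rule homotopic_through_homeos_cong) (auto simp: compose_eq gg' g'im)
    then show "g \<otimes>\<^bsub>homeo_group S \<omega>\<^esub> f \<otimes>\<^bsub>homeo_group S \<omega>\<^esub> ?g' \<in> homeo_0 S \<omega>"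
      using G.m_closed[OF G.m_closed[OF g f] g'] conj by (simp add: homeo_0_def)
  qed
qed

section \<open>Equivalence of markings\<close>

lemma marked_surfacesD:
  assumes "(X, f) \<in> marked_surfaces S \<omega>"
  shows "is_orientation (mtopology_of (fst X)) (snd X)"
    and "oriented_homeo S \<omega> (mtopology_of (fst X)) (snd X) f"
    and "homeomorphic_map S (mtopology_of (fst X)) f"
  using assms
  by (auto simp: marked_surfaces_def hyperbolic_surface_def oriented_surface_def oriented_homeo_def)

section \<open>Isometries between hyperbolic surfaces\<close>

lemma oriented_isometry_imp_homeomorphic_map:
  "oriented_isometry X Y \<phi> \<Longrightarrow> homeomorphic_map (mtopology_of (fst X)) (mtopology_of (fst Y)) \<phi>"
  by (simp add: oriented_isometry_def oriented_homeo_def)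

lemma oriented_isometry_imp_bij_betw:
  "oriented_isometry X Y \<phi> \<Longrightarrow> bij_betw \<phi> (mspace (fst X)) (mspace (fst Y))"
  using oriented_isometry_imp_homeomorphic_map[of X Y \<phi>]
  by (simp add: homeomorphic_eq_everything_map bij_betw_def)

lemma oriented_isometry_id:
  assumes "is_orientation (mtopology_of (fst X)) (snd X)"
  shows "oriented_isometry X X id"
  using oriented_homeo_id[OF assms] by (simp add: oriented_isometry_def)

lemma oriented_isometry_compose:
  assumes "oriented_isometry X Y \<phi>" and "oriented_isometry Y Z \<theta>"
  shows "oriented_isometry X Z (\<theta> \<circ> \<phi>)"
  using assms bij_betwE[OF oriented_isometry_imp_bij_betw[OF assms(1)]]
  by (simp add: oriented_isometry_def oriented_homeo_compose[of _ _ "mtopology_of (fst Y)" "snd Y"])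

lemma oriented_isometry_inv_into:
  assumes \<phi>: "oriented_isometry X Y \<phi>" and "is_orientation (mtopology_of (fst X)) (snd X)"
  shows "oriented_isometry Y X (inv_into (mspace (fst X)) \<phi>)" (is "oriented_isometry Y X ?\<theta>")
  unfolding oriented_isometry_def
proof (intro conjI ballI)
  have "oriented_homeo (mtopology_of (fst X)) (snd X) (mtopology_of (fst Y)) (snd Y) \<phi>"
    using \<phi> by (simp add: oriented_isometry_def)
  from oriented_homeo_inv_into[OF this assms(2)]
  show "oriented_homeo (mtopology_of (fst Y)) (snd Y) (mtopology_of (fst X)) (snd X) ?\<theta>"
    by simp
  have "?\<theta> y \<in> mspace (fst X)" "\<phi> (?\<theta> y) = y" if "y \<in> mspace (fst Y)" for y
    using that oriented_isometry_imp_bij_betw[OF \<phi>]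
    by (simp_all add: bij_betw_def f_inv_into_f inv_into_into)
  moreover fix x y assume "x \<in> mspace (fst Y)" "y \<in> mspace (fst Y)"
  moreover have "mdist (fst Y) (\<phi> u) (\<phi> v) = mdist (fst X) u v"
    if "u \<in> mspace (fst X)" "v \<in> mspace (fst X)" for u v
    using \<phi> that by (simp add: oriented_isometry_def)
  ultimately show "mdist (fst X) (?\<theta> x) (?\<theta> y) = mdist (fst Y) x y"
    by metis
qed

text \<open>Homotopies survive precomposition with \<open>f1\<close> and with its inverse, and these
  cancel on the underlying spaces. In this form both homotopic maps start at \<open>S\<close> and no
  inverse of a marking occurs.\<close>

lemma marking_rel_iff:
  "((X1, f1), (X2, f2)) \<in> marking_rel S \<omega> \<longleftrightarrow>
     (X1, f1) \<in> marked_surfaces S \<omega> \<and> (X2, f2) \<in> marked_surfaces S \<omega> \<and>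
     (\<exists>\<phi>. oriented_isometry X1 X2 \<phi> \<and>
        homotopic_with (\<lambda>_. True) S (mtopology_of (fst X2)) (\<phi> \<circ> f1) f2)"
proof -
  have "homotopic_with (\<lambda>_. True) (mtopology_of (fst X1)) (mtopology_of (fst X2))
           \<phi> (f2 \<circ> inv_into (topspace S) f1) \<longleftrightarrow>
        homotopic_with (\<lambda>_. True) S (mtopology_of (fst X2)) (\<phi> \<circ> f1) f2"
      (is "?L \<longleftrightarrow> ?R")
    if "(X1, f1) \<in> marked_surfaces S \<omega>" for \<phi>
  proof -
    let ?g = "inv_into (topspace S) f1"
    have "homeomorphic_maps S (mtopology_of (fst X1)) f1 ?g"
      using marked_surfacesD(3)[OF that] by (rule homeomorphic_maps_inv_into)
    then have f: "continuous_map S (mtopology_of (fst X1)) f1"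
      and g: "continuous_map (mtopology_of (fst X1)) S ?g"
      and gf: "\<And>x. x \<in> topspace S \<Longrightarrow> ?g (f1 x) = x"
      and fg: "\<And>y. y \<in> topspace (mtopology_of (fst X1)) \<Longrightarrow> f1 (?g y) = y"
      by (auto simp: homeomorphic_maps_def)
    show ?thesis
    proof
      assume ?L
      then have "homotopic_with (\<lambda>_. True) S (mtopology_of (fst X2)) (\<phi> \<circ> f1) (f2 \<circ> ?g \<circ> f1)"
        using f by (rule homotopic_with_compose_continuous_map_right) simp
      then show ?R
        by (rule homotopic_with_eq) (auto simp: gf)
    next
      assume ?R
      then have "homotopic_with (\<lambda>_. True) (mtopology_of (fst X1)) (mtopology_of (fst X2))
          (\<phi> \<circ> f1 \<circ> ?g) (f2 \<circ> ?g)"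
        using g by (rule homotopic_with_compose_continuous_map_right) simp
      then show ?L
        by (rule homotopic_with_eq) (use fg in auto)
    qed
  qed
  then show ?thesis
    unfolding marking_rel_def by blast
qed

text \<open>Reflexivity uses the identity isometry. For symmetry, apply the inverse isometry to the
  homotopy from \<open>\<phi> \<circ> f\<close> to \<open>g\<close>; for transitivity, apply
  \<open>\<theta>\<close> to it and append the homotopy from \<open>\<theta> \<circ> g\<close> to
  \<open>h\<close>.\<close>

lemma equiv_marking_rel: "equiv (marked_surfaces S \<omega>) (marking_rel S \<omega>)"
proof (rule equivI)
  show "marking_rel S \<omega> \<subseteq> marked_surfaces S \<omega> \<times> marked_surfaces S \<omega>"
    by (auto simp: marking_rel_def)
  show "refl_on (marked_surfaces S \<omega>) (marking_rel S \<omega>)"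
  proof (rule refl_onI)
    fix p assume p: "p \<in> marked_surfaces S \<omega>"
    obtain X f where [simp]: "p = (X, f)"
      by (cases p)
    have "oriented_isometry X X id"
      using p by (auto intro: oriented_isometry_id marked_surfacesD(1))
    moreover have "homotopic_with (\<lambda>_. True) S (mtopology_of (fst X)) (id \<circ> f) f"
      using p by (auto intro: homeomorphic_imp_continuous_map marked_surfacesD(3))
    ultimately show "(p, p) \<in> marking_rel S \<omega>"
      using p by (auto simp: marking_rel_iff)
  qed
  show "sym (marking_rel S \<omega>)"
  proof (rule symI)
    fix p q assume pq: "(p, q) \<in> marking_rel S \<omega>"
    obtain X f Y g where [simp]: "p = (X, f)" "q = (Y, g)"
      by (cases p, cases q)
    have p: "(X, f) \<in> marked_surfaces S \<omega>" and q: "(Y, g) \<in> marked_surfaces S \<omega>"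
      using pq by (auto simp: marking_rel_iff)
    obtain \<phi> where \<phi>: "oriented_isometry X Y \<phi>"
      and hom: "homotopic_with (\<lambda>_. True) S (mtopology_of (fst Y)) (\<phi> \<circ> f) g"
      using pq by (auto simp: marking_rel_iff)
    let ?\<theta> = "inv_into (mspace (fst X)) \<phi>"
    have \<theta>: "oriented_isometry Y X ?\<theta>"
      using \<phi> marked_surfacesD(1)[OF p] by (rule oriented_isometry_inv_into)
    have "?\<theta> (\<phi> (f x)) = f x" if "x \<in> topspace S" for x
    proof -
      have "f x \<in> mspace (fst X)"
        using that homeomorphic_imp_surjective_map[OF marked_surfacesD(3)[OF p]] by auto
      moreover have "inj_on \<phi> (mspace (fst X))"
        using oriented_isometry_imp_bij_betw[OF \<phi>] by (simp add: bij_betw_def)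
      ultimately show ?thesis
        by simp
    qed
    moreover have "homotopic_with (\<lambda>_. True) S (mtopology_of (fst X)) (?\<theta> \<circ> g) (?\<theta> \<circ> (\<phi> \<circ> f))"
      using homotopic_with_symD[OF hom] homeomorphic_imp_continuous_map[OF oriented_isometry_imp_homeomorphic_map[OF \<theta>]]
      by (rule homotopic_with_compose_continuous_map_left) simp
    ultimately have "homotopic_with (\<lambda>_. True) S (mtopology_of (fst X)) (?\<theta> \<circ> g) f"
      by (elim homotopic_with_eq) auto
    then show "(q, p) \<in> marking_rel S \<omega>"
      using p q \<theta> by (auto simp: marking_rel_iff)
  qed
  show "trans (marking_rel S \<omega>)"
  proof (rule transI)
    fix p q r assume pq: "(p, q) \<in> marking_rel S \<omega>" and qr: "(q, r) \<in> marking_rel S \<omega>"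
    obtain X f Y g Z h where [simp]: "p = (X, f)" "q = (Y, g)" "r = (Z, h)"
      by (cases p, cases q, cases r)
    obtain \<phi> where \<phi>: "oriented_isometry X Y \<phi>"
      and hom: "homotopic_with (\<lambda>_. True) S (mtopology_of (fst Y)) (\<phi> \<circ> f) g"
      using pq by (auto simp: marking_rel_iff)
    obtain \<theta> where \<theta>: "oriented_isometry Y Z \<theta>"
      and hom': "homotopic_with (\<lambda>_. True) S (mtopology_of (fst Z)) (\<theta> \<circ> g) h"
      using qr by (auto simp: marking_rel_iff)
    have "homotopic_with (\<lambda>_. True) S (mtopology_of (fst Z)) (\<theta> \<circ> (\<phi> \<circ> f)) (\<theta> \<circ> g)"
      using hom homeomorphic_imp_continuous_map[OF oriented_isometry_imp_homeomorphic_map[OF \<theta>]]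
      by (rule homotopic_with_compose_continuous_map_left) simp
    then have "homotopic_with (\<lambda>_. True) S (mtopology_of (fst Z)) (\<theta> \<circ> \<phi> \<circ> f) h"
      using hom' by (auto simp: o_assoc intro: homotopic_with_trans)
    then show "(p, r) \<in> marking_rel S \<omega>"
      using pq qr oriented_isometry_compose[OF \<phi> \<theta>] by (auto simp: marking_rel_iff)
  qed
qed

section \<open>The action on Teichmueller space\<close>

text \<open>The action on representatives. Using \<open>compose\<close> keeps the new marking
  extensional, as \<open>marked_surfaces\<close> demands.\<close>

definition change_marking ::
  "'a topology \<Rightarrow> ('a \<Rightarrow> 'a) \<Rightarrow> ('a, 'b) marked \<Rightarrow> ('a, 'b) marked" where
  "change_marking S \<psi> = (\<lambda>(X, f). (X, compose (topspace S) f (inv_into (topspace S) \<psi>)))"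

text \<open>The outer \<open>compose\<close> evaluates the inverse only on
  \<open>topspace S\<close>, so restricting it changes nothing. This makes the group laws for
  inverses available.\<close>

lemma change_marking_eq_inv:
  assumes "is_orientation S \<omega>" and "\<psi> \<in> carrier (homeo_group S \<omega>)"
  shows "change_marking S \<psi> (X, f) = (X, compose (topspace S) f (inv\<^bsub>homeo_group S \<omega>\<^esub> \<psi>))"
  by (simp add: change_marking_def inv_homeo_group[OF assms] compose_def restrict_def fun_eq_iff)

lemma change_marking_closed:
  assumes "is_orientation S \<omega>" and \<psi>: "\<psi> \<in> carrier (homeo_group S \<omega>)"
    and p: "p \<in> marked_surfaces S \<omega>"
  shows "change_marking S \<psi> p \<in> marked_surfaces S \<omega>"
proof -
  obtain X f where [simp]: "p = (X, f)"
    by (cases p)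
  have "oriented_homeo S \<omega> S \<omega> (inv_into (topspace S) \<psi>)"
    using assms by (intro oriented_homeo_inv_into) (auto simp: carrier_homeo_group)
  moreover have "oriented_homeo S \<omega> (mtopology_of (fst X)) (snd X) f"
    using p marked_surfacesD(2) by simp
  ultimately have "oriented_homeo S \<omega> (mtopology_of (fst X)) (snd X) (f \<circ> inv_into (topspace S) \<psi>)"
    by (rule oriented_homeo_compose)
  then have "oriented_homeo S \<omega> (mtopology_of (fst X)) (snd X)
      (compose (topspace S) f (inv_into (topspace S) \<psi>))"
    by (rule oriented_homeo_cong) (simp add: compose_eq)
  then show ?thesis
    using p by (simp add: marked_surfaces_def change_marking_def)
qed

text \<open>Inversion reverses products and so does precomposition; together they give a left
  action, already on representatives.\<close>

lemma change_marking_mult: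
  assumes "is_orientation S \<omega>"
    and \<psi>: "\<psi> \<in> carrier (homeo_group S \<omega>)" and \<theta>: "\<theta> \<in> carrier (homeo_group S \<omega>)"
  shows "change_marking S (\<psi> \<otimes>\<^bsub>homeo_group S \<omega>\<^esub> \<theta>) p = change_marking S \<psi> (change_marking S \<theta> p)"
proof -
  interpret G: group "homeo_group S \<omega>"
    using assms(1) by (rule group_homeo_group)
  obtain X f where [simp]: "p = (X, f)"
    by (cases p)
  \<comment> \<open>\<open>compose_assoc\<close> requires the innermost map to send
    \<open>topspace S\<close> into itself; after inverting the product this map is the inverse of
    \<open>\<psi>\<close>.\<close>
  have "inv\<^bsub>homeo_group S \<omega>\<^esub> \<psi> \<in> topspace S \<rightarrow> topspace S"
    using G.inv_closed[OF \<psi>] by (simp add: carrier_homeo_group Bij_imp_funcset)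
  then show ?thesis
    using change_marking_eq_inv[OF assms(1) G.m_closed[OF \<psi> \<theta>]] \<psi> \<theta>
    by (simp add: change_marking_eq_inv[OF assms(1)] G.inv_mult_group)
      (simp add: mult_homeo_group compose_assoc)
qed

text \<open>The same isometry serves as witness, since both markings are precomposed with the same
  continuous map.\<close>

lemma change_marking_marking_rel:
  assumes "is_orientation S \<omega>" and \<psi>: "\<psi> \<in> carrier (homeo_group S \<omega>)"
    and pq: "(p, q) \<in> marking_rel S \<omega>"
  shows "(change_marking S \<psi> p, change_marking S \<psi> q) \<in> marking_rel S \<omega>"
proof -
  obtain X f Y g where [simp]: "p = (X, f)" "q = (Y, g)"
    by (cases p, cases q)
  let ?h = "inv_into (topspace S) \<psi>"
  obtain \<phi> where \<phi>: "oriented_isometry X Y \<phi>"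
    and hom: "homotopic_with (\<lambda>_. True) S (mtopology_of (fst Y)) (\<phi> \<circ> f) g"
    using pq by (auto simp: marking_rel_iff)
  have "continuous_map S S ?h"
    using homeomorphic_maps_inv_into[OF homeo_group_imp_homeomorphic_map[OF \<psi>]]
    by (simp add: homeomorphic_maps_def)
  with hom have "homotopic_with (\<lambda>_. True) S (mtopology_of (fst Y)) (\<phi> \<circ> f \<circ> ?h) (g \<circ> ?h)"
    by (rule homotopic_with_compose_continuous_map_right) simp
  then have "homotopic_with (\<lambda>_. True) S (mtopology_of (fst Y))
      (\<phi> \<circ> compose (topspace S) f ?h) (compose (topspace S) g ?h)"
    by (rule homotopic_with_eq) (auto simp: compose_eq)
  moreover have "change_marking S \<psi> p \<in> marked_surfaces S \<omega>"
    "change_marking S \<psi> q \<in> marked_surfaces S \<omega>"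
    using pq assms(1) \<psi> by (auto simp: marking_rel_iff intro!: change_marking_closed)
  ultimately show ?thesis
    using \<phi> by (auto simp: change_marking_def marking_rel_iff)
qed

text \<open>The witness is the identity isometry: on \<open>topspace S\<close>, \<open>f\<close>
  equals \<open>f \<circ> \<psi> \<circ> \<psi>\<inverse>\<close>, and contracting
  \<open>\<psi>\<close> to \<open>id\<close> deforms this to
  \<open>f \<circ> \<psi>\<inverse>\<close>.\<close>

lemma change_marking_homeo_0:
  assumes "is_orientation S \<omega>" and \<psi>: "\<psi> \<in> homeo_0 S \<omega>" and p: "p \<in> marked_surfaces S \<omega>"
  shows "(p, change_marking S \<psi> p) \<in> marking_rel S \<omega>"
proof -
  obtain X f where [simp]: "p = (X, f)"
    by (cases p)
  let ?h = "inv_into (topspace S) \<psi>"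
  have \<psi>G: "\<psi> \<in> carrier (homeo_group S \<omega>)"
    and hom: "homotopic_with (homeomorphic_map S S) S S \<psi> id"
    using \<psi> by (auto simp: homeo_0_def)
  have inv: "homeomorphic_maps S S \<psi> ?h"
    using homeo_group_imp_homeomorphic_map[OF \<psi>G] by (rule homeomorphic_maps_inv_into)
  have "continuous_map S S ?h" "continuous_map S (mtopology_of (fst X)) f"
    using inv p by (auto simp: homeomorphic_maps_def
        intro: homeomorphic_imp_continuous_map marked_surfacesD(3))
  \<comment> \<open>The isotopy is weakened to a homotopy, because equivalence of markings speaks of
    homotopies only.\<close>
  moreover have "homotopic_with (\<lambda>_. True) S S \<psi> id"
    using hom by (rule homotopic_with_mono) simp
  ultimately have "homotopic_with (\<lambda>_. True) S (mtopology_of (fst X)) (f \<circ> (\<psi> \<circ> ?h)) (f \<circ> (id \<circ> ?h))"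
    by (intro homotopic_with_compose_continuous_map_left[where p = "\<lambda>_. True"]
        homotopic_with_compose_continuous_map_right[where p = "\<lambda>_. True"]) auto
  then have "homotopic_with (\<lambda>_. True) S (mtopology_of (fst X)) (id \<circ> f) (compose (topspace S) f ?h)"
    by (rule homotopic_with_eq) (use inv in \<open>auto simp: compose_eq homeomorphic_maps_def\<close>)
  moreover have "oriented_isometry X X id"
    using p by (auto intro: oriented_isometry_id marked_surfacesD(1))
  moreover have "change_marking S \<psi> p \<in> marked_surfaces S \<omega>"
    using assms(1) \<psi>G p by (rule change_marking_closed)
  ultimately show ?thesis
    using p by (auto simp: change_marking_def marking_rel_iff)
qed

section \<open>Descent to equivalence classes of marked surfaces\<close>

text \<open>The union avoids choosing a representative: all its members will turn out to be the same
  class. The restriction makes the map extensional, as \<open>Bij\<close> requires.\<close>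

definition teichmueller_action ::
  "'a topology \<Rightarrow> 'a orientation \<Rightarrow> ('a \<Rightarrow> 'a) \<Rightarrow> ('a, 'b) marked set \<Rightarrow> ('a, 'b) marked set" where
  "teichmueller_action S \<omega> \<psi> =
     (\<lambda>c \<in> teichmueller S \<omega>. \<Union>p \<in> c. marked_class S \<omega> (change_marking S \<psi> p))"

lemma marked_class_in_teichmueller:
  "p \<in> marked_surfaces S \<omega> \<Longrightarrow> marked_class S \<omega> p \<in> teichmueller S \<omega>"
  by (simp add: teichmueller_def marked_class_def quotientI)

lemma teichmuellerE:
  assumes "c \<in> teichmueller S \<omega>"
  obtains p where "p \<in> marked_surfaces S \<omega>" and "c = marked_class S \<omega> p"
  using assms by (auto simp: teichmueller_def marked_class_def elim: quotientE)

lemma marked_class_eqI: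
  "(p, q) \<in> marking_rel S \<omega> \<Longrightarrow> marked_class S \<omega> p = marked_class S \<omega> q"
  unfolding marked_class_def using equiv_marking_rel by (rule equiv_class_eq)

text \<open>Equivalent representatives have equivalent images, so the union is over copies of a
  single class. This is the independence of the representative \<open>(X, f)\<close>.\<close>

lemma teichmueller_action_marked_class:
  assumes "is_orientation S \<omega>" and "\<psi> \<in> carrier (homeo_group S \<omega>)"
    and p: "p \<in> marked_surfaces S \<omega>"
  shows "teichmueller_action S \<omega> \<psi> (marked_class S \<omega> p) = marked_class S \<omega> (change_marking S \<psi> p)"
proof -
  have "(\<lambda>p. marked_class S \<omega> (change_marking S \<psi> p)) respects marking_rel S \<omega>"
    using assms by (auto intro!: congruentI marked_class_eqI change_marking_marking_rel)
  then have "(\<Union>q \<in> marking_rel S \<omega> `` {p}. marked_class S \<omega> (change_marking S \<psi> q))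
      = marked_class S \<omega> (change_marking S \<psi> p)"
    using equiv_marking_rel p by (intro UN_equiv_class)
  then show ?thesis
    using marked_class_in_teichmueller[OF p]
    \<comment> \<open>The restriction is resolved first, while \<open>marked_class\<close> is still
      folded as in the membership fact; only then is the union exposed.\<close>
    by (simp add: teichmueller_action_def) (simp add: marked_class_def)
qed

lemma teichmueller_action_closed:
  assumes "is_orientation S \<omega>" and "\<psi> \<in> carrier (homeo_group S \<omega>)" and "c \<in> teichmueller S \<omega>"
  shows "teichmueller_action S \<omega> \<psi> c \<in> teichmueller S \<omega>"
  using assms(3)
proof (rule teichmuellerE)
  fix p assume "p \<in> marked_surfaces S \<omega>" "c = marked_class S \<omega> p"
  then show ?thesis
    using assms(1,2) by (simp add: teichmueller_action_marked_class marked_class_in_teichmueller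
        change_marking_closed)
qed

text \<open>This is the independence of the representative \<open>\<psi>\<close> of a mapping class:
  it places \<open>homeo_0\<close> in the kernel of the action.\<close>

lemma teichmueller_action_homeo_0:
  assumes "is_orientation S \<omega>" and "\<psi> \<in> homeo_0 S \<omega>"
  shows "teichmueller_action S \<omega> \<psi> = (\<lambda>c \<in> teichmueller S \<omega>. c)"
proof (rule extensionalityI)
  fix c :: "('a, 'b) marked set" assume "c \<in> teichmueller S \<omega>"
  moreover have "\<psi> \<in> carrier (homeo_group S \<omega>)"
    using assms(2) by (simp add: homeo_0_def)
  ultimately show "teichmueller_action S \<omega> \<psi> c = (\<lambda>c \<in> teichmueller S \<omega>. c) c"
    using assms
    by (elim teichmuellerE) (simp add: teichmueller_action_marked_class
        marked_class_in_teichmueller marked_class_eqI[OF change_marking_homeo_0, symmetric])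
qed (simp_all add: teichmueller_action_def)

lemma teichmueller_action_mult:
  assumes "is_orientation S \<omega>"
    and "\<psi> \<in> carrier (homeo_group S \<omega>)" and "\<theta> \<in> carrier (homeo_group S \<omega>)"
  shows "teichmueller_action S \<omega> (\<psi> \<otimes>\<^bsub>homeo_group S \<omega>\<^esub> \<theta>) =
    compose (teichmueller S \<omega>) (teichmueller_action S \<omega> \<psi>) (teichmueller_action S \<omega> \<theta>)"
proof (rule extensionalityI)
  interpret G: group "homeo_group S \<omega>"
    using assms(1) by (rule group_homeo_group)
  fix c :: "('a, 'b) marked set" assume "c \<in> teichmueller S \<omega>"
  then show "teichmueller_action S \<omega> (\<psi> \<otimes>\<^bsub>homeo_group S \<omega>\<^esub> \<theta>) c =
    compose (teichmueller S \<omega>) (teichmueller_action S \<omega> \<psi>) (teichmueller_action S \<omega> \<theta>) c"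
    using assms by (elim teichmuellerE) (simp add: compose_eq teichmueller_action_marked_class
        marked_class_in_teichmueller change_marking_closed change_marking_mult)
qed (simp_all add: teichmueller_action_def)

text \<open>The actions of \<open>\<psi>\<close> and of its inverse undo each other by
  multiplicativity, as the unit acts trivially.\<close>

lemma teichmueller_action_Bij:
  assumes "is_orientation S \<omega>" and \<psi>: "\<psi> \<in> carrier (homeo_group S \<omega>)"
  shows "teichmueller_action S \<omega> \<psi> \<in> Bij (teichmueller S \<omega>)"
proof -
  interpret G: group "homeo_group S \<omega>"
    using assms(1) by (rule group_homeo_group)
  have cancel: "teichmueller_action S \<omega> \<theta> (teichmueller_action S \<omega> \<rho> c) = c"
    if "\<theta> \<in> carrier (homeo_group S \<omega>)" "\<rho> \<in> carrier (homeo_group S \<omega>)"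
      "\<theta> \<otimes>\<^bsub>homeo_group S \<omega>\<^esub> \<rho> = \<one>\<^bsub>homeo_group S \<omega>\<^esub>" "c \<in> teichmueller S \<omega>"
    for \<theta> \<rho> and c :: "('a, 'b) marked set"
  proof -
    \<comment> \<open>Triviality of the unit is read off as a special case of triviality on
      \<open>homeo_0\<close>.\<close>
    have "\<one>\<^bsub>homeo_group S \<omega>\<^esub> \<in> homeo_0 S \<omega>"
      using subgroup_homeo_0[OF assms(1)] by (rule subgroup.one_closed)
    then have "compose (teichmueller S \<omega>) (teichmueller_action S \<omega> \<theta>) (teichmueller_action S \<omega> \<rho>) c = c"
      using teichmueller_action_mult[OF assms(1) that(1,2)] that(3,4)
        teichmueller_action_homeo_0[OF assms(1)] by (metis restrict_apply')
    then show ?thesis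
      using that(4) by (simp add: compose_eq)
  qed
  have "bij_betw (teichmueller_action S \<omega> \<psi>) (teichmueller S \<omega> :: ('a, 'b) marked set set)
      (teichmueller S \<omega>)"
    by (rule bij_betw_byWitness[where f' = "teichmueller_action S \<omega> (inv\<^bsub>homeo_group S \<omega>\<^esub> \<psi>)"])
      (use \<psi> in \<open>simp_all add: cancel teichmueller_action_closed[OF assms(1)] image_subset_iff\<close>)
  then show ?thesis
    by (simp add: Bij_def teichmueller_action_def)
qed

lemma group_hom_teichmueller_action:
  assumes "is_orientation S \<omega>"
  shows "group_hom (homeo_group S \<omega>) (BijGroup (teichmueller S \<omega>)) (teichmueller_action S \<omega>)"
    (is "group_hom ?G ?H ?A")
proof -
  have "?A \<in> hom ?G ?H"
    by (rule homI)
      (simp_all add: BijGroup_def teichmueller_action_Bij[OF assms] teichmueller_action_mult[OF assms])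
  then show ?thesis
    using group_homeo_group[OF assms] group_BijGroup by (simp add: group_hom_def group_hom_axioms_def)
qed

text \<open>The homomorphism from \<open>homeo_group\<close> to the bijections of Teichmueller space
  kills \<open>homeo_0\<close>, so it factors through the quotient \<open>MCG\<close>. Evaluating
  the factor map on cosets gives the formula.\<close>

theorem proposition3:
  fixes S :: "'a topology" and \<omega> :: "'a orientation"
  assumes "oriented_surface S \<omega>"
    and "connected_space S"
    and "nonabelian_fundamental_group S"
  shows "\<exists>A :: ('a \<Rightarrow> 'a) set \<Rightarrow> ('a, 'b) marked set \<Rightarrow> ('a, 'b) marked set.
    group_action (MCG S \<omega>) (teichmueller S \<omega>) A \<and>
    (\<forall>\<psi> \<in> carrier (homeo_group S \<omega>). \<forall>(X, f) \<in> marked_surfaces S \<omega>.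
       A (mapping_class S \<omega> \<psi>) (marked_class S \<omega> (X, f)) =
         marked_class S \<omega> (X, compose (topspace S) f (inv_into (topspace S) \<psi>)))"
proof -
  have or: "is_orientation S \<omega>"
    using assms(1) by (simp add: oriented_surface_def)
  let ?T = "teichmueller S \<omega> :: ('a, 'b) marked set set"
  interpret act: group_hom "homeo_group S \<omega>" "BijGroup ?T" "teichmueller_action S \<omega>"
    using or by (rule group_hom_teichmueller_action)
  have "homeo_0 S \<omega> \<subseteq> kernel (homeo_group S \<omega>) (BijGroup ?T) (teichmueller_action S \<omega>)"
    using teichmueller_action_homeo_0[OF or]
    by (auto simp: kernel_def BijGroup_def homeo_0_def)
  then obtain A :: "('a \<Rightarrow> 'a) set \<Rightarrow> ('a, 'b) marked set \<Rightarrow> ('a, 'b) marked set"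
    where A: "A \<in> hom (MCG S \<omega>) (BijGroup ?T)"
      and A_class: "\<And>\<psi>. \<psi> \<in> carrier (homeo_group S \<omega>) \<Longrightarrow>
        A (mapping_class S \<omega> \<psi>) = teichmueller_action S \<omega> \<psi>"
    unfolding MCG_def mapping_class_def
    \<comment> \<open>The universal property of the quotient supplies \<open>A\<close> together with
      its values on the cosets of \<open>homeo_0\<close>, which are the mapping classes.\<close>
    using act.FactGroup_universal_kernel[OF normal_homeo_0[OF or]] by metis
  have "group (MCG S \<omega>)"
    unfolding MCG_def using normal_homeo_0[OF or] by (rule normal.factorgroup_is_group)
  then have "group_action (MCG S \<omega>) ?T A"
    using A act.H.is_group by (simp add: group_action_def group_hom_def group_hom_axioms_def)
  moreover have "A (mapping_class S \<omega> \<psi>) (marked_class S \<omega> (X, f)) =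
      marked_class S \<omega> (X, compose (topspace S) f (inv_into (topspace S) \<psi>))"
    if "\<psi> \<in> carrier (homeo_group S \<omega>)" "(X, f) \<in> marked_surfaces S \<omega>" for \<psi> X and f :: "'a \<Rightarrow> 'b"
    using that by (simp add: A_class teichmueller_action_marked_class[OF or] change_marking_def)
  ultimately show ?thesis
    by blast
qed

end
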